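(* For every integer $k\ge 2$: (1) $C(4k,2k,4,5)\le 14$ if $k$ is even; (2) $C(4k,2k,4,5)\le 18$ if $k$ is odd; (3) $C(6k,2k,4,6)\le 42$ if $k\equiv 0 \pmod 3$; (4) $C(6k,2k,4,6)\le 51$ if $k\equiv 1,2 \pmod 3$; (5) $C(8k,2k,4,6)\le 140$ if $k\equiv 0 \pmod 4$.
   Context: A $(v,k,t,m)$ cover is a pair $(X,\mathcal{B})$ with $|X|=v$ and $\mathcal{B}$ a collection of $k$-subsets of $X$ such that every $m$-subset of $X$ meets some block in at least $t$ points. $C(v,k,t,m)$ denotes the minimum number of blocks in a $(v,k,t,m)$ cover. *)

theory Defs
  imports Main
begin

definition is_cover ::
    "nat \<Rightarrow> nat \<Rightarrow> nat \<Rightarrow> nat \<Rightarrow> 'a set \<Rightarrow> 'a set set \<Rightarrow> bool" where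
  "is_cover v k t m X \<B> \<longleftrightarrow>
     finite X \<and> card X = v \<and>
     (\<forall>B\<in>\<B>. B \<subseteq> X \<and> card B = k) \<and>
     (\<forall>M. M \<subseteq> X \<and> card M = m \<longrightarrow> (\<exists>B\<in>\<B>. t \<le> card (M \<inter> B)))"

text \<open>
  Being a cover is invariant under bijections of the ground set, so it is enough to minimise over
  ground sets of natural numbers. A repeated block never helps to cover, so collections of blocks
  are taken to be sets. If no cover with the given parameters exists, the \<^const>\<open>Least\<close> below
  is unspecified; the lemmas after it show that this does not happen
  when \<open>t \<le> k \<le> v\<close> and \<open>t \<le> m\<close>.
\<close>

definition cover_number :: "nat \<Rightarrow> nat \<Rightarrow> nat \<Rightarrow> nat \<Rightarrow> nat" where
  "cover_number v k t m =
     (LEAST b. \<exists>(X :: nat set) \<B>. is_cover v k t m X \<B> \<and> card \<B> = b)"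

lemma is_cover_all_blocks:
  assumes "finite X" "card X = v" "t \<le> k" "k \<le> v" "t \<le> m"
  shows "is_cover v k t m X {B. B \<subseteq> X \<and> card B = k}"
proof -
  have "\<exists>B. B \<subseteq> X \<and> card B = k \<and> t \<le> card (M \<inter> B)" if M: "M \<subseteq> X" "card M = m" for M
  proof -
    obtain T where T: "T \<subseteq> M" "card T = t"
      using M assms(5) by (metis obtain_subset_with_card_n)
    moreover obtain B where B: "T \<subseteq> B" "B \<subseteq> X" "card B = k"
      using T M assms exists_subset_between[of T k X] by (metis subset_trans)
    moreover have "card T \<le> card (M \<inter> B)"
      using T B M assms(1) by (intro card_mono) (auto intro: finite_subset)
    ultimately show ?thesis by auto
  qed
  then show ?thesis
    using assms by (auto simp: is_cover_def)
qed

lemma cover_number_attained: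
  assumes "t \<le> k" "k \<le> v" "t \<le> m"
  shows "\<exists>(X :: nat set) \<B>. is_cover v k t m X \<B> \<and> card \<B> = cover_number v k t m"
  unfolding cover_number_def
proof (rule LeastI_ex)
  show "\<exists>b (X :: nat set) \<B>. is_cover v k t m X \<B> \<and> card \<B> = b"
    using is_cover_all_blocks[of "{..<v}" v t k m] assms by auto
qed

end

theory Submission
  imports Defs
begin

text \<open>
  Split the point set into two halves and give each half the same family of partitions
  (directions) such that any two points lie in a common class of some direction. The main blocks
  are the unions of a class in one half with a class of the same direction in the other half.
  If three points are not all in one class, then their three pairs agree in three different
  directions, so with at most five directions such triples in the two halves share a direction and
  a block meets the two triples in 2 + 2 points; otherwise some block contains 3 + 1 points. If one
  half contains two points, their direction has to be met by a pair of the other half, which is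
  the pigeonhole principle or is repaired by blocks inside one half; these blocks also deal with
  five or more points in one half. The directions come from the three perfect matchings of \<open>K\<^sub>4\<close>
  (parts 1 and 2), from the affine plane of order 3 (part 3), from a 1-factorization of \<open>K\<^sub>6\<close>
  enlarged to all sizes (part 4), and from the affine plane of order 4 (part 5).
\<close>

section \<open>Passing to convenient ground sets and smaller blocks\<close>

text \<open>\<open>cover_number\<close> minimises over sets of naturals only. Transport along a
  bijection onto \<open>{..<v}\<close> makes covers on products and sums of sets usable.\<close>

lemma cover_number_le:
  fixes X :: "'a set"
  assumes "is_cover v k t m X \<B>" and "card \<B> \<le> n"
  shows "cover_number v k t m \<le> n"
proof -
  have X: "finite X" "card X = v" using assms(1) by (auto simp: is_cover_def)
  then obtain h :: "'a \<Rightarrow> nat" where h: "bij_betw h X {..<v}"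
    by (metis card_lessThan finite_lessThan finite_same_card_bij)
  then have inj: "inj_on h X" and im: "h ` X = {..<v}" by (auto simp: bij_betw_def)
  have fin: "finite \<B>"
    by (rule finite_subset[of _ "Pow X"]) (use assms(1) X in \<open>auto simp: is_cover_def\<close>)
  have "is_cover v k t m {..<v} ((`) h ` \<B>)"
    unfolding is_cover_def
  proof (intro conjI allI impI ballI)
    fix B assume "B \<in> (`) h ` \<B>"
    then obtain B' where B': "B = h ` B'" "B' \<subseteq> X" "card B' = k"
      using assms(1) by (auto simp: is_cover_def)
    show "B \<subseteq> {..<v}" using B' im by blast
    show "card B = k" using B' inj by (metis card_image inj_on_subset)
  next
    fix M assume M: "M \<subseteq> {..<v} \<and> card M = m"
    then obtain M' where M': "M' \<subseteq> X" "M = h ` M'" using im by (metis subset_imageE)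
    then have "card M' = m" using M inj by (metis card_image inj_on_subset)
    then obtain B where B: "B \<in> \<B>" "t \<le> card (M' \<inter> B)"
      using assms(1) M' by (auto simp: is_cover_def)
    have "B \<subseteq> X" using assms(1) B by (auto simp: is_cover_def)
    then have "M \<inter> h ` B = h ` (M' \<inter> B)"
      using M' inj by (simp add: inj_on_image_Int)
    also have "card \<dots> = card (M' \<inter> B)"
      using M' inj by (intro card_image) (meson inf.coboundedI1 inj_on_subset)
    finally show "\<exists>B\<in>(`) h ` \<B>. t \<le> card (M \<inter> B)"
      using B by (intro bexI[of _ "h ` B"]) auto
  qed auto
  then have "cover_number v k t m \<le> card ((`) h ` \<B>)"
    unfolding cover_number_def by (intro Least_le) blast
  also have "\<dots> \<le> card \<B>" using fin by (rule card_image_le)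
  finally show ?thesis using assms(2) by simp
qed

text \<open>Enlarging a block preserves coverage, so blocks with fewer than \<open>k\<close> points
  can be filled up inside \<open>X\<close>; blocks that become equal only lower the count.\<close>

lemma cover_number_le_padded:
  fixes X :: "'a set"
  assumes X: "finite X" "card X = v" "k \<le> v"
    and fin: "finite \<B>" "card \<B> \<le> n"
    and blocks: "\<And>B. B \<in> \<B> \<Longrightarrow> B \<subseteq> X \<and> card B \<le> k"
    and cov: "\<And>M. M \<subseteq> X \<Longrightarrow> card M = m \<Longrightarrow> \<exists>B\<in>\<B>. t \<le> card (M \<inter> B)"
  shows "cover_number v k t m \<le> n"
proof -
  have "\<forall>B\<in>\<B>. \<exists>C. B \<subseteq> C \<and> C \<subseteq> X \<and> card C = k"
    using blocks X exists_subset_between by metis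
  then obtain c where c: "\<And>B. B \<in> \<B> \<Longrightarrow> B \<subseteq> c B \<and> c B \<subseteq> X \<and> card (c B) = k"
    by metis
  have "is_cover v k t m X (c ` \<B>)"
    unfolding is_cover_def
  proof (intro conjI allI impI)
    fix M assume M: "M \<subseteq> X \<and> card M = m"
    then obtain B where B: "B \<in> \<B>" "t \<le> card (M \<inter> B)" using cov by blast
    have "card (M \<inter> B) \<le> card (M \<inter> c B)"
      using c[OF B(1)] M X by (intro card_mono) (auto intro: finite_subset)
    then show "\<exists>B\<in>c ` \<B>. t \<le> card (M \<inter> B)" using B by force
  qed (use X c in auto)
  then show ?thesis
    using card_image_le[OF fin(1), of c] fin(2) by (intro cover_number_le[of v k t m X "c ` \<B>"]) auto
qed

text \<open>The disjoint sum keeps the halves apart even when both are the same set, so that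
  intersection sizes simply add.\<close>

lemma cover_number_two_parts:
  fixes A :: "'a set" and B :: "'b set"
  assumes AB: "finite A" "finite B" "card A + card B = v" "k \<le> v"
    and fin: "finite F" "card F \<le> n"
    and blocks: "\<And>U V. (U, V) \<in> F \<Longrightarrow> U \<subseteq> A \<and> V \<subseteq> B \<and> card U + card V \<le> k"
    and cov: "\<And>P Q. P \<subseteq> A \<Longrightarrow> Q \<subseteq> B \<Longrightarrow> card P + card Q = m \<Longrightarrow>
                \<exists>(U, V)\<in>F. t \<le> card (P \<inter> U) + card (Q \<inter> V)"
  shows "cover_number v k t m \<le> n"
proof (rule cover_number_le_padded[where X = "A <+> B" and \<B> = "(\<lambda>(U, V). U <+> V) ` F"])
  show "card ((\<lambda>(U, V). U <+> V) ` F) \<le> n"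
    using card_image_le[OF fin(1)] fin(2) le_trans by blast
  fix C assume "C \<in> (\<lambda>(U, V). U <+> V) ` F"
  then obtain U V where UV: "(U, V) \<in> F" "C = U <+> V" by auto
  moreover have "finite U" "finite V" using blocks[OF UV(1)] AB by (auto intro: finite_subset)
  ultimately show "C \<subseteq> A <+> B \<and> card C \<le> k"
    using blocks[OF UV(1)] by (auto simp: card_Plus)
next
  fix M assume M: "M \<subseteq> A <+> B" "card M = m"
  define P Q where "P = Inl -` M" and "Q = Inr -` M"
  have eq: "M = P <+> Q" using M(1) by (auto simp: P_def Q_def Plus_def)
  have PQ: "P \<subseteq> A" "Q \<subseteq> B" using M(1) by (auto simp: P_def Q_def)
  then have fPQ: "finite P" "finite Q" using AB by (auto intro: finite_subset)
  then have "card P + card Q = m" using M(2) eq by (simp add: card_Plus)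
  from cov[OF PQ this] obtain U V
    where UV: "(U, V) \<in> F" "t \<le> card (P \<inter> U) + card (Q \<inter> V)" by auto
  have "M \<inter> (U <+> V) = (P \<inter> U) <+> (Q \<inter> V)" using eq by auto
  then have "card (M \<inter> (U <+> V)) = card (P \<inter> U) + card (Q \<inter> V)"
    using fPQ by (simp add: card_Plus)
  then show "\<exists>C\<in>(\<lambda>(U, V). U <+> V) ` F. t \<le> card (M \<inter> C)"
    using UV by force
qed (use AB fin in \<open>auto simp: card_Plus\<close>)

section \<open>Blocks joining classes of one direction\<close>

definition part :: "('d \<Rightarrow> 'p \<Rightarrow> 'l) \<Rightarrow> 'p set \<Rightarrow> 'd \<Rightarrow> 'l \<Rightarrow> 'p set" where
  "part f A d i = {p \<in> A. f d p = i}"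

definition matched_parts ::
    "('d \<Rightarrow> 'p \<Rightarrow> 'l) \<Rightarrow> 'd set \<Rightarrow> 'l set \<Rightarrow> 'p set \<Rightarrow> 'p set \<Rightarrow> ('p set \<times> 'p set) set" where
  "matched_parts f D L A B = (\<lambda>(d, i, j). (part f A d i, part f B d j)) ` (D \<times> L \<times> L)"

lemma part_subset: "part f A d i \<subseteq> A"
  by (auto simp: part_def)

lemma card_matched_parts_le:
  assumes "finite D" "finite L"
  shows "finite (matched_parts f D L A B)"
    and "card (matched_parts f D L A B) \<le> card D * (card L)\<^sup>2"
proof -
  show "finite (matched_parts f D L A B)" using assms by (simp add: matched_parts_def)
  have "card (matched_parts f D L A B) \<le> card (D \<times> L \<times> L)"
    unfolding matched_parts_def by (rule card_image_le) (use assms in simp)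
  then show "card (matched_parts f D L A B) \<le> card D * (card L)\<^sup>2"
    by (simp add: card_cartesian_product power2_eq_square)
qed

lemma matched_parts_cover:
  assumes "S \<subseteq> P \<inter> part f A d i" "T \<subseteq> Q \<inter> part f B d j"
    and "d \<in> D" "i \<in> L" "j \<in> L" "finite P" "finite Q" "n \<le> card S + card T"
  shows "\<exists>(U, V)\<in>matched_parts f D L A B. n \<le> card (P \<inter> U) + card (Q \<inter> V)"
proof (rule bexI)
  show "(part f A d i, part f B d j) \<in> matched_parts f D L A B"
    using assms(3-5) unfolding matched_parts_def by (intro image_eqI[of _ _ "(d, i, j)"]) auto
  have "card S \<le> card (P \<inter> part f A d i)" "card T \<le> card (Q \<inter> part f B d j)"
    using assms by (auto intro!: card_mono)
  then show "case (part f A d i, part f B d j) of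
      (U, V) \<Rightarrow> n \<le> card (P \<inter> U) + card (Q \<inter> V)"
    using assms by simp
qed

lemma pigeonhole_pair:
  assumes "g ` P \<subseteq> L" "finite L" "card L < card P"
  shows "\<exists>p\<in>P. \<exists>q\<in>P. p \<noteq> q \<and> g p = g q"
  using pigeonhole[of g P] card_mono[OF assms(2,1)] assms(3) by (auto simp: inj_on_def)

text \<open>The two points of \<open>Q\<close> dictate the direction, and \<open>meet\<close>
  supplies a pair of \<open>P\<close> in whichever direction that is. Both orders of the halves are
  stated because \<open>matched_parts\<close> consists of ordered pairs.\<close>

lemma matched_parts_cover_pair:
  assumes lab: "\<And>d p. d \<in> D \<Longrightarrow> p \<in> A \<union> B \<Longrightarrow> f d p \<in> L"
    and agree: "\<And>p q. p \<in> A \<union> B \<Longrightarrow> q \<in> A \<union> B \<Longrightarrow> \<exists>d\<in>D. f d p = f d q"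
    and "P \<subseteq> A" "Q \<subseteq> B" "finite P" "card Q = 2"
    and meet: "\<And>d. d \<in> D \<Longrightarrow> \<exists>p\<in>P. \<exists>q\<in>P. p \<noteq> q \<and> f d p = f d q"
  shows "\<exists>(U, V)\<in>matched_parts f D L A B. 4 \<le> card (P \<inter> U) + card (Q \<inter> V)"
    and "\<exists>(U, V)\<in>matched_parts f D L B A. 4 \<le> card (Q \<inter> U) + card (P \<inter> V)"
proof -
  obtain x y where Q: "Q = {x, y}" "x \<noteq> y" using \<open>card Q = 2\<close> by (auto simp: card_2_iff)
  obtain d where d: "d \<in> D" "f d x = f d y" using agree[of x y] Q \<open>Q \<subseteq> B\<close> by blast
  obtain p q where pq: "p \<in> P" "q \<in> P" "p \<noteq> q" "f d p = f d q" using meet d by blast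
  have *: "f d p \<in> L" "f d x \<in> L" using lab d pq Q assms by auto
  show "\<exists>(U, V)\<in>matched_parts f D L A B. 4 \<le> card (P \<inter> U) + card (Q \<inter> V)"
    by (rule matched_parts_cover[where S = "{p, q}" and T = Q and d = d and i = "f d p" and j = "f d x"])
      (use assms Q d pq * in \<open>auto simp: part_def\<close>)
  show "\<exists>(U, V)\<in>matched_parts f D L B A. 4 \<le> card (Q \<inter> U) + card (P \<inter> V)"
    by (rule matched_parts_cover[where S = Q and T = "{p, q}" and d = d and i = "f d x" and j = "f d p"])
      (use assms Q d pq * in \<open>auto simp: part_def\<close>)
qed

text \<open>Any two of the three pairs share a point. If they agree in the same direction,
  transitivity puts the whole triple into one class; otherwise the three directions are
  distinct.\<close>

lemma triple_in_part_or_three_directions: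
  assumes "finite D"
    and agree: "\<And>p q. p \<in> P \<Longrightarrow> q \<in> P \<Longrightarrow> \<exists>d\<in>D. f d p = f d q"
    and "card P = 3"
  shows "(\<exists>d\<in>D. \<exists>i. \<forall>p\<in>P. f d p = i) \<or>
         3 \<le> card {d \<in> D. \<exists>p\<in>P. \<exists>q\<in>P. p \<noteq> q \<and> f d p = f d q}"
proof -
  obtain x y z where P: "P = {x, y, z}" "x \<noteq> y" "y \<noteq> z" "x \<noteq> z"
    using \<open>card P = 3\<close> by (auto simp: card_3_iff)
  obtain a b c where d: "a \<in> D" "f a x = f a y" "b \<in> D" "f b y = f b z" "c \<in> D" "f c x = f c z"
    using agree[of x y] agree[of y z] agree[of x z] P(1) by blast
  show ?thesis
  proof (cases "a = b \<or> b = c \<or> a = c")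
    case True
    then obtain e where "e \<in> D" "f e x = f e y" "f e y = f e z"
    proof (elim disjE)
      assume "b = c"
      then show thesis using d that[of b] by simp
    qed (use d that[of a] in simp_all)
    then have "\<forall>p\<in>P. f e p = f e x" using P by simp
    then show ?thesis using \<open>e \<in> D\<close> by blast
  next
    case False
    have "{a, b, c} \<subseteq> {d \<in> D. \<exists>p\<in>P. \<exists>q\<in>P. p \<noteq> q \<and> f d p = f d q}"
      using d P by auto
    then have "card {a, b, c} \<le> card {d \<in> D. \<exists>p\<in>P. \<exists>q\<in>P. p \<noteq> q \<and> f d p = f d q}"
      using \<open>finite D\<close> by (intro card_mono) auto
    then show ?thesis using False by simp
  qed
qed

lemma matched_parts_cover_triples:
  assumes D: "finite D" "card D \<le> 5"
    and lab: "\<And>d p. d \<in> D \<Longrightarrow> p \<in> H \<Longrightarrow> f d p \<in> L"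
    and agree: "\<And>p q. p \<in> H \<Longrightarrow> q \<in> H \<Longrightarrow> \<exists>d\<in>D. f d p = f d q"
    and PQ: "P \<subseteq> H" "Q \<subseteq> H" "card P = 3" "card Q = 3"
  shows "\<exists>(U, V)\<in>matched_parts f D L H H. 4 \<le> card (P \<inter> U) + card (Q \<inter> V)"
proof -
  have fin: "finite P" "finite Q" using PQ by (auto intro: card_ge_0_finite)
  define E where "E = (\<lambda>P. {d \<in> D. \<exists>p\<in>P. \<exists>q\<in>P. p \<noteq> q \<and> f d p = f d q})"
  have line: "(\<exists>d\<in>D. \<exists>i. \<forall>p\<in>R. f d p = i) \<or> 3 \<le> card (E R)" if "R \<subseteq> H" "card R = 3" for R
  proof -
    have "\<exists>d\<in>D. f d p = f d q" if "p \<in> R" "q \<in> R" for p q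
      using agree that \<open>R \<subseteq> H\<close> by blast
    from triple_in_part_or_three_directions[OF D(1) this \<open>card R = 3\<close>] show ?thesis
      by (simp add: E_def)
  qed
  obtain x y where xy: "x \<in> P" "y \<in> Q" using PQ by fastforce
  consider (P) d i where "d \<in> D" "\<forall>p\<in>P. f d p = i" | (Q) d i where "d \<in> D" "\<forall>p\<in>Q. f d p = i"
    | (E) "3 \<le> card (E P)" "3 \<le> card (E Q)"
    using line[OF PQ(1,3)] line[OF PQ(2,4)] by blast
  then show ?thesis
  proof cases
    case P
    then have "i \<in> L" "f d y \<in> L" using lab[of d x] lab[of d y] xy PQ by auto
    then show ?thesis
      by (intro matched_parts_cover[where S = P and T = "{y}" and d = d and i = i and j = "f d y"])
        (use P xy PQ fin in \<open>auto simp: part_def\<close>)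
  next
    case Q
    then have "i \<in> L" "f d x \<in> L" using lab[of d x] lab[of d y] xy PQ by auto
    then show ?thesis
      by (intro matched_parts_cover[where S = "{x}" and T = Q and d = d and i = "f d x" and j = i])
        (use Q xy PQ fin in \<open>auto simp: part_def\<close>)
  next
    case E
    \<comment> \<open>Disjoint sets of at least three directions each would need six
      directions.\<close>
    have "E P \<inter> E Q \<noteq> {}"
    proof
      assume "E P \<inter> E Q = {}"
      moreover have "finite (E P)" "finite (E Q)" "E P \<union> E Q \<subseteq> D" using D by (auto simp: E_def)
      ultimately have "card (E P) + card (E Q) \<le> card D"
        using D by (metis card_Un_disjoint card_mono)
      then show False using E D by simp
    qed
    then obtain d p q r s where d: "d \<in> D" "p \<in> P" "q \<in> P" "p \<noteq> q" "f d p = f d q"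
      "r \<in> Q" "s \<in> Q" "r \<noteq> s" "f d r = f d s"
      by (auto simp: E_def)
    show ?thesis
      by (rule matched_parts_cover[where S = "{p, q}" and T = "{r, s}" and d = d
            and i = "f d p" and j = "f d r"])
        (use d PQ lab fin in \<open>auto simp: part_def\<close>)
  qed
qed

section \<open>Covers for 6-subsets from labelled halves\<close>

text \<open>The six points split as 3 + 3, 4 + 2 or with at least five in one half. \<open>G\<close>
  holds the extra blocks inside a half and is used once in each half, hence
  \<open>2 * card G\<close>.\<close>

lemma cover_number_matched_parts:
  fixes H :: "'p set" and f :: "'d \<Rightarrow> 'p \<Rightarrow> 'l" and G :: "'p set set"
  assumes H: "finite H" "c \<le> card H"
    and D: "finite D" "card D \<le> 5"
    and L: "finite L"
    and lab: "\<And>d p. d \<in> D \<Longrightarrow> p \<in> H \<Longrightarrow> f d p \<in> L"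
    and agree: "\<And>p q. p \<in> H \<Longrightarrow> q \<in> H \<Longrightarrow> \<exists>d\<in>D. f d p = f d q"
    and size: "\<And>d i. d \<in> D \<Longrightarrow> i \<in> L \<Longrightarrow> card (part f H d i) \<le> c"
    and G: "finite G" "\<And>U. U \<in> G \<Longrightarrow> U \<subseteq> H \<and> card U \<le> 2 * c"
    and four: "\<And>P d. P \<subseteq> H \<Longrightarrow> card P = 4 \<Longrightarrow> d \<in> D \<Longrightarrow>
                (\<exists>p\<in>P. \<exists>q\<in>P. p \<noteq> q \<and> f d p = f d q) \<or> (\<exists>U\<in>G. P \<subseteq> U)"
    and five: "\<And>P. P \<subseteq> H \<Longrightarrow> card P = 5 \<Longrightarrow> \<exists>U\<in>G. 4 \<le> card (P \<inter> U)"
    and n: "card D * (card L)\<^sup>2 + 2 * card G \<le> n"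
  shows "cover_number (2 * card H) (2 * c) 4 6 \<le> n"
proof -
  define N where "N = matched_parts f D L H H"
  define F where "F = N \<union> (\<lambda>U. (U, {})) ` G \<union> (\<lambda>U. ({}, U)) ` G"
  have "card F \<le> card N + card ((\<lambda>U. (U, {} :: 'p set)) ` G) + card ((\<lambda>U. ({} :: 'p set, U)) ` G)"
    unfolding F_def by (meson add_le_mono1 card_Un_le order_trans)
  also have "\<dots> \<le> card D * (card L)\<^sup>2 + card G + card G"
    unfolding N_def by (intro add_mono card_matched_parts_le card_image_le D L G)
  finally have cF: "card F \<le> n" using n by simp
  have five': "\<exists>U\<in>G. 4 \<le> card (P \<inter> U)" if P: "P \<subseteq> H" "5 \<le> card P" for P
  proof -
    obtain R where R: "R \<subseteq> P" "card R = 5" using P(2) by (metis obtain_subset_with_card_n)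
    then obtain U where U: "U \<in> G" "4 \<le> card (R \<inter> U)" using five P by blast
    have "card (R \<inter> U) \<le> card (P \<inter> U)"
      using R P H by (intro card_mono) (auto intro: finite_subset)
    then show ?thesis using U by force
  qed
  \<comment> \<open>If no block of \<open>G\<close> contains \<open>P\<close>, then
    \<open>four\<close> yields an agreeing pair in every direction, as the 4 + 2 case
    requires.\<close>
  have four': "(\<exists>U\<in>G. 4 \<le> card (P \<inter> U)) \<or> (\<forall>d\<in>D. \<exists>p\<in>P. \<exists>q\<in>P. p \<noteq> q \<and> f d p = f d q)"
    if P: "P \<subseteq> H" "card P = 4" for P
    using four[OF P] P(2) by (metis inf.absorb1 order_refl)
  show ?thesis
  proof (rule cover_number_two_parts[where A = H and B = H and F = F])
    show "finite F" unfolding F_def N_def using D L G by (simp add: card_matched_parts_le)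
    fix U V assume "(U, V) \<in> F"
    then show "U \<subseteq> H \<and> V \<subseteq> H \<and> card U + card V \<le> 2 * c"
      unfolding F_def N_def matched_parts_def
      using G(2) add_mono[OF size size] part_subset by (fastforce simp: mult_2)
  next
    fix P Q assume PQ: "P \<subseteq> H" "Q \<subseteq> H" "card P + card Q = 6"
    have fin: "finite P" "finite Q" using PQ H by (auto intro: finite_subset)
    show "\<exists>(U, V)\<in>F. 4 \<le> card (P \<inter> U) + card (Q \<inter> V)"
    proof -
      have "card P = 3 \<and> card Q = 3 \<or> card P = 4 \<and> card Q = 2 \<or> card P = 2 \<and> card Q = 4 \<or>
          5 \<le> card P \<or> 5 \<le> card Q"
        using PQ(3) by linarith
      then have "(\<exists>U\<in>G. 4 \<le> card (P \<inter> U)) \<or> (\<exists>U\<in>G. 4 \<le> card (Q \<inter> U)) \<or>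
          (\<exists>(U, V)\<in>N. 4 \<le> card (P \<inter> U) + card (Q \<inter> V))"
      proof (elim disjE conjE)
        assume "card P = 3" "card Q = 3"
        then show ?thesis
          using matched_parts_cover_triples[of D H f L P Q] D lab agree PQ
          unfolding N_def by simp
      next
        assume c: "card P = 4" "card Q = 2"
        show ?thesis
          using matched_parts_cover_pair(1)[of D H H f L P Q] four'[OF PQ(1) c(1)] c(2)
            lab agree PQ fin
          unfolding N_def by auto
      next
        assume c: "card P = 2" "card Q = 4"
        show ?thesis
          using matched_parts_cover_pair(2)[of D H H f L Q P] four'[OF PQ(2) c(2)] c(1)
            lab agree PQ fin
          unfolding N_def by auto
      qed (use five'[of P] five'[of Q] PQ in simp_all)
      then show ?thesis
      proof (elim disjE)
        assume "\<exists>U\<in>G. 4 \<le> card (P \<inter> U)"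
        then obtain U where "U \<in> G" "4 \<le> card (P \<inter> U)" by blast
        then show ?thesis unfolding F_def by (intro bexI[of _ "(U, {})"]) auto
      next
        assume "\<exists>U\<in>G. 4 \<le> card (Q \<inter> U)"
        then obtain U where "U \<in> G" "4 \<le> card (Q \<inter> U)" by blast
        then show ?thesis unfolding F_def by (intro bexI[of _ "({}, U)"]) auto
      qed (auto simp: F_def)
    qed
  qed (use H cF in auto)
qed


text \<open>With three labels, four points agree somewhere in every direction by pigeonhole, so only
  five points in one half need extra blocks. The complements of the three classes of one fixed
  direction suffice, which adds 3 blocks per half.\<close>

lemma cover_number_three_parts:
  fixes H :: "'p set" and f :: "'d \<Rightarrow> 'p \<Rightarrow> nat"
  assumes H: "finite H" "c \<le> card H"
    and D: "finite D" "D \<noteq> {}" "card D \<le> 5"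
    and lab: "\<And>d p. d \<in> D \<Longrightarrow> p \<in> H \<Longrightarrow> f d p < 3"
    and agree: "\<And>p q. p \<in> H \<Longrightarrow> q \<in> H \<Longrightarrow> \<exists>d\<in>D. f d p = f d q"
    and size: "\<And>d i. d \<in> D \<Longrightarrow> i < 3 \<Longrightarrow> card (part f H d i) \<le> c"
  shows "cover_number (2 * card H) (2 * c) 4 6 \<le> 9 * card D + 6"
proof -
  obtain e where e: "e \<in> D" using D by blast
  define G where "G = (\<lambda>i. H - part f H e i) ` {..<3::nat}"
  have split: "P = (\<Union>i\<in>{..<3}. P \<inter> part f H e i)" if "P \<subseteq> H" for P
    using that lab[OF e] by (auto simp: part_def)
  have card_split: "card P = (\<Sum>i<3. card (P \<inter> part f H e i))" if "P \<subseteq> H" for P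
  proof -
    have "card P = card (\<Union>i\<in>{..<3}. P \<inter> part f H e i)" using split[OF that] by simp
    also have "\<dots> = (\<Sum>i<3. card (P \<inter> part f H e i))"
      using finite_subset[OF that H(1)] by (intro card_UN_disjoint) (auto simp: part_def)
    finally show ?thesis .
  qed
  show ?thesis
  proof (rule cover_number_matched_parts[where f = f and D = D and L = "{..<3}" and G = G])
    show "card D * (card {..<3::nat})\<^sup>2 + 2 * card G \<le> 9 * card D + 6"
      using card_image_le[of "{..<3::nat}" "\<lambda>i. H - part f H e i"] by (simp add: G_def)
  next
    fix U assume "U \<in> G"
    then obtain i where i: "i < 3" "U = H - part f H e i" by (auto simp: G_def)
    \<comment> \<open>Classes are bounded only from above, so the size of the complement is
      estimated by adding up the two remaining classes.\<close>
    have "card (U \<inter> part f H e j) \<le> (if j = i then 0 else c)" if "j < 3" for j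
    proof (cases "j = i")
      case False
      have "card (U \<inter> part f H e j) \<le> card (part f H e j)"
        using H by (intro card_mono) (auto intro: finite_subset[OF part_subset])
      then show ?thesis using size[OF e that] False by simp
    next
      case True
      then have "U \<inter> part f H e j = {}" using i by blast
      then show ?thesis by simp
    qed
    then have "(\<Sum>j<3. card (U \<inter> part f H e j)) \<le> (\<Sum>j<3. if j = i then 0 else c)"
      by (intro sum_mono) simp
    also have "\<dots> = 2 * c" using i(1) by (auto simp: numeral_eq_Suc less_Suc_eq)
    finally show "U \<subseteq> H \<and> card U \<le> 2 * c" using card_split[of U] i by auto
  next
    fix P d assume "P \<subseteq> H" "card P = 4" "d \<in> D"
    then have "\<exists>p\<in>P. \<exists>q\<in>P. p \<noteq> q \<and> f d p = f d q"
      using lab[of d] by (intro pigeonhole_pair[where L = "{..<3}"]) auto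
    then show "(\<exists>p\<in>P. \<exists>q\<in>P. p \<noteq> q \<and> f d p = f d q) \<or> (\<exists>U\<in>G. P \<subseteq> U)" ..
  next
    fix P assume P: "P \<subseteq> H" "card P = 5"
    \<comment> \<open>Three classes with at least two points each would contain six of the five
      points.\<close>
    have "\<exists>i<3. card (P \<inter> part f H e i) \<le> 1"
    proof (rule ccontr)
      assume "\<not> ?thesis"
      then have "(\<Sum>i<3::nat. 2) \<le> (\<Sum>i<3. card (P \<inter> part f H e i))"
        by (intro sum_mono) (auto simp: not_le)
      then show False using card_split[OF P(1)] P(2) by simp
    qed
    then obtain i where i: "i < 3" "card (P \<inter> part f H e i) \<le> 1" by blast
    have "P \<inter> (H - part f H e i) = P - P \<inter> part f H e i" using P by blast
    moreover have "card \<dots> = 5 - card (P \<inter> part f H e i)"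
      using P finite_subset[OF P(1) H(1)] by (subst card_Diff_subset) auto
    ultimately show "\<exists>U\<in>G. 4 \<le> card (P \<inter> U)"
      using i by (auto simp: G_def intro!: bexI[of _ i])
  qed (use assms in \<open>auto simp: G_def\<close>)
qed

section \<open>Direction tables and covers of 6k points\<close>

text \<open>Blowing up group \<open>g\<close> to \<open>w g\<close> points that inherit its labels
  turns class sizes into weighted row counts of a table.\<close>

lemma card_part_Sigma:
  assumes "finite S"
  shows "card (part (\<lambda>d p. f d (fst p)) (SIGMA g:S. {..<w g}) d i) = (\<Sum>g\<in>S. if f d g = i then w g else 0)"
proof -
  have "part (\<lambda>d p. f d (fst p)) (SIGMA g:S. {..<w g}) d i = (SIGMA g:{g \<in> S. f d g = i}. {..<w g})"
    by (auto simp: part_def)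
  then show ?thesis using assms by (simp add: sum.inter_filter)
qed

text \<open>
  Row \<open>d\<close> of a table lists the classes, in direction \<open>d\<close>, of the groups into which a half is
  divided; groups are then replaced by sets of points of given sizes.
\<close>

definition table_K4 :: "nat list list" where
  "table_K4 = [[0,0,1,1], [0,1,0,1], [0,1,1,0]]"

text \<open>Column 3s + t is the point (s, t) over the field with three elements; the rows are s, t,
  t + s and t + 2s.\<close>

definition table_AG23 :: "nat list list" where
  "table_AG23 =
    [[0,0,0,1,1,1,2,2,2],
     [0,1,2,0,1,2,0,1,2],
     [0,1,2,1,2,0,2,0,1],
     [0,1,2,2,0,1,1,2,0]]"

text \<open>
  The first six columns come from the five perfect matchings of a 1-factorization of \<open>K\<^sub>6\<close>, where
  any two vertices are matched exactly once. The last nine, found by computer search, agree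
  pairwise and with the first six. As the first six columns contain each symbol twice and
  the last nine contain it three times in every row, giving them weights \<open>a\<close> and \<open>b\<close> yields
  classes of equal size \<open>2a + 3b\<close>, and every \<open>k \<ge> 2\<close> has this form.
\<close>

definition table_mixed :: "nat list list" where
  "table_mixed =
    [[0,0,1,1,2,2,0,0,0,1,1,2,1,2,2],
     [0,1,0,2,1,2,0,0,2,0,2,1,1,1,2],
     [0,1,2,0,2,1,0,1,0,2,2,2,1,0,1],
     [0,1,2,1,0,2,0,1,2,2,1,0,2,1,0],
     [0,1,1,2,2,0,0,2,2,1,0,2,0,1,1]]"

lemma table_K4_agree: "\<forall>g<4. \<forall>h<4. \<exists>d<3. table_K4 ! d ! g = table_K4 ! d ! h"
  by code_simp

lemma table_AG23_agree: "\<forall>g<9. \<forall>h<9. \<exists>d<4. table_AG23 ! d ! g = table_AG23 ! d ! h"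
  by code_simp

lemma table_mixed_agree: "\<forall>g<15. \<forall>h<15. \<exists>d<5. table_mixed ! d ! g = table_mixed ! d ! h"
  by code_simp

lemma table_K4_less: "\<forall>d<3. \<forall>g<4. table_K4 ! d ! g < 2"
  by code_simp

lemma table_AG23_less: "\<forall>d<4. \<forall>g<9. table_AG23 ! d ! g < 3"
  by code_simp

lemma table_mixed_less: "\<forall>d<5. \<forall>g<15. table_mixed ! d ! g < 3"
  by code_simp

lemma table_K4_sum:
  assumes "d < 3" "i < 2"
  shows "(\<Sum>g<4. if table_K4 ! d ! g = i then w else 0) = 2 * (w::nat)"
proof -
  have "d = 0 \<or> d = 1 \<or> d = 2" "i = 0 \<or> i = 1" using assms by linarith+
  then show ?thesis
    by (elim disjE; simp add: table_K4_def lessThan_nat_numeral)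
qed

lemma table_AG23_sum:
  assumes "d < 4" "i < 3"
  shows "(\<Sum>g<9. if table_AG23 ! d ! g = i then w else 0) = 3 * (w::nat)"
proof -
  have "d = 0 \<or> d = 1 \<or> d = 2 \<or> d = 3" "i = 0 \<or> i = 1 \<or> i = 2" using assms by linarith+
  then show ?thesis
    by (elim disjE; simp add: table_AG23_def lessThan_nat_numeral)
qed

lemma table_mixed_sum:
  assumes "d < 5" "i < 3"
  shows "(\<Sum>g<15. if table_mixed ! d ! g = i then if g < 6 then a else b else 0) = 2 * a + 3 * (b::nat)"
proof -
  have "d = 0 \<or> d = 1 \<or> d = 2 \<or> d = 3 \<or> d = 4" "i = 0 \<or> i = 1 \<or> i = 2" using assms by linarith+
  then show ?thesis
    by (elim disjE; simp add: table_mixed_def lessThan_nat_numeral)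
qed

lemma cover_number_6k_of_table:
  fixes T :: "nat list list"
  assumes D: "0 < D" "D \<le> 5"
    and lab: "\<forall>d<D. \<forall>g<n. T ! d ! g < 3"
    and agree: "\<forall>g<n. \<forall>h<n. \<exists>d<D. T ! d ! g = T ! d ! h"
    and size: "\<And>d i. d < D \<Longrightarrow> i < 3 \<Longrightarrow> (\<Sum>g<n. if T ! d ! g = i then w g else 0) = k"
  shows "cover_number (6 * k) (2 * k) 4 6 \<le> 9 * D + 6"
proof -
  define H where "H = (SIGMA g:{..<n}. {..<w g})"
  define f where "f = (\<lambda>d (p :: nat \<times> nat). T ! d ! fst p)"
  have size': "card (part f H d i) = k" if "d < D" "i < 3" for d i
    using card_part_Sigma[of "{..<n}" "\<lambda>d g. T ! d ! g" w d i] size[OF that]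
    by (simp add: f_def H_def)
  \<comment> \<open>Direction 0 splits the half into three classes of \<open>k\<close>
    points.\<close>
  have "card H = (\<Sum>g<n. w g)" by (simp add: H_def)
  also have "\<dots> = (\<Sum>g<n. \<Sum>i<3::nat. if T ! 0 ! g = i then w g else 0)"
    using lab D by (intro sum.cong refl) auto
  also have "\<dots> = (\<Sum>i<3::nat. k)"
    using size D by (subst sum.swap) (auto intro!: sum.cong)
  finally have H: "card H = 3 * k" by simp
  have "cover_number (2 * card H) (2 * k) 4 6 \<le> 9 * card {..<D} + 6"
  proof (rule cover_number_three_parts[where f = f])
    fix p q assume "p \<in> H" "q \<in> H"
    then have "fst p < n" "fst q < n" by (auto simp: H_def)
    then show "\<exists>d\<in>{..<D}. f d p = f d q" using agree unfolding f_def by blast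
  next
  qed (use D lab H size' in \<open>auto simp: H_def f_def\<close>)
  then show ?thesis using H by simp
qed

lemma cover_number_6k_3_dvd:
  assumes "k mod 3 = 0"
  shows "cover_number (6 * k) (2 * k) 4 6 \<le> 42"
proof -
  have "3 * (k div 3) = k" using assms by auto
  then show ?thesis
    using cover_number_6k_of_table[of 4 9 table_AG23 "\<lambda>_. k div 3" k]
      table_AG23_less table_AG23_agree table_AG23_sum by simp
qed

text \<open>Five directions with three labels give 9 * 5 + 6 blocks.\<close>

lemma cover_number_6k:
  assumes "k \<ge> 2"
  shows "cover_number (6 * k) (2 * k) 4 6 \<le> 51"
proof -
  obtain a b where "k = 2 * a + 3 * b"
  proof (cases "even k")
    case True
    then show thesis using that[of "k div 2" 0] by simp
  next
    case False
    then obtain j where "k = 2 * j + 1" by (elim oddE)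
    \<comment> \<open>Here 2j + 1 = 2(j - 1) + 3, and \<open>k \<ge> 2\<close> gives j >= 1, so the
      subtraction is exact.\<close>
    then show thesis using that[of "j - 1" 1] assms by simp
  qed
  then show ?thesis
    using cover_number_6k_of_table[of 5 15 table_mixed "\<lambda>g. if g < 6 then a else b" k]
      table_mixed_less table_mixed_agree table_mixed_sum by simp
qed

section \<open>Covers of 4k points for 5-subsets\<close>

text \<open>With two labels, three points already agree somewhere in every direction.\<close>

lemma matched_parts_cover_3_2:
  assumes L: "finite L" "card L = 2"
    and lab: "\<And>d p. d \<in> D \<Longrightarrow> p \<in> A \<union> B \<Longrightarrow> f d p \<in> L"
    and agree: "\<And>p q. p \<in> A \<union> B \<Longrightarrow> q \<in> A \<union> B \<Longrightarrow> \<exists>d\<in>D. f d p = f d q"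
    and "P \<subseteq> A" "Q \<subseteq> B" "card P = 3" "card Q = 2"
  shows "\<exists>(U, V)\<in>matched_parts f D L A B. 4 \<le> card (P \<inter> U) + card (Q \<inter> V)"
    and "\<exists>(U, V)\<in>matched_parts f D L B A. 4 \<le> card (Q \<inter> U) + card (P \<inter> V)"
proof -
  have "\<exists>p\<in>P. \<exists>q\<in>P. p \<noteq> q \<and> f d p = f d q" if "d \<in> D" for d
    using lab[OF that] L \<open>P \<subseteq> A\<close> \<open>card P = 3\<close> by (intro pigeonhole_pair[where L = L]) auto
  moreover have "finite P" using \<open>card P = 3\<close> by (auto intro: card_ge_0_finite)
  ultimately show "\<exists>(U, V)\<in>matched_parts f D L A B. 4 \<le> card (P \<inter> U) + card (Q \<inter> V)"
    "\<exists>(U, V)\<in>matched_parts f D L B A. 4 \<le> card (Q \<inter> U) + card (P \<inter> V)"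
    using matched_parts_cover_pair[of D A B f L P Q] lab agree assms(5-8) by simp_all
qed

text \<open>Shared core of both parities. A matched block has 2u + 2v = 2k points however the halves
  are balanced, which permits unequal halves for odd \<open>k\<close>. The 12 matched blocks settle
  3 + 2; the rest is left to \<open>G\<close>.\<close>

lemma cover_number_4k_of_extra_blocks:
  fixes u v :: nat and A B :: "(nat \<times> nat) set" and f :: "nat \<Rightarrow> nat \<times> nat \<Rightarrow> nat"
  defines "A \<equiv> {..<4} \<times> {..<u}" and "B \<equiv> {..<4} \<times> {..<v}"
    and "f \<equiv> (\<lambda>d p. table_K4 ! d ! fst p)"
  assumes k: "u + v = k"
    and G: "finite G" "12 + card G \<le> n"
    and blocks: "\<And>U V. (U, V) \<in> G \<Longrightarrow> U \<subseteq> A \<and> V \<subseteq> B \<and> card U + card V \<le> 2 * k"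
    and cov: "\<And>P Q. P \<subseteq> A \<Longrightarrow> Q \<subseteq> B \<Longrightarrow> card P + card Q = 5 \<Longrightarrow> 4 \<le> card P \<or> 4 \<le> card Q \<Longrightarrow>
      \<exists>(U, V)\<in>matched_parts f {..<3} {..<2} A B \<union> G. 4 \<le> card (P \<inter> U) + card (Q \<inter> V)"
  shows "cover_number (4 * k) (2 * k) 4 5 \<le> n"
proof -
  define N where "N = matched_parts f {..<3} {..<2} A B"
  have size: "card (part f ({..<4} \<times> {..<w}) d i) = 2 * w" if "d < 3" "i < 2" for d i w
    using card_part_Sigma[of "{..<4}" "\<lambda>d g. table_K4 ! d ! g" "\<lambda>_. w" d i] table_K4_sum[OF that]
    by (simp add: f_def)
  have lab: "f d p \<in> {..<2}" if "d \<in> {..<3}" "p \<in> A \<union> B" for d p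
    using that table_K4_less by (auto simp: f_def A_def B_def)
  have agree: "\<exists>d\<in>{..<3}. f d p = f d q" if "p \<in> A \<union> B" "q \<in> A \<union> B" for p q
  proof -
    have "fst p < 4" "fst q < 4" using that by (auto simp: A_def B_def)
    then show ?thesis using table_K4_agree unfolding f_def by blast
  qed
  have AB: "finite A" "finite B" "card A + card B = 4 * k" by (auto simp: A_def B_def k[symmetric])
  show ?thesis
  proof (rule cover_number_two_parts[where A = A and B = B and F = "N \<union> G"])
    have "card N \<le> 12"
      using card_matched_parts_le(2)[of "{..<3::nat}" "{..<2::nat}" f A B] by (simp add: N_def)
    then show "card (N \<union> G) \<le> n" using card_Un_le[of N G] G by linarith
    fix U V assume "(U, V) \<in> N \<union> G"
    then consider "(U, V) \<in> N" | "(U, V) \<in> G" by blast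
    then show "U \<subseteq> A \<and> V \<subseteq> B \<and> card U + card V \<le> 2 * k"
    proof cases
      case 1
      then obtain d i j where "d < 3" "i < 2" "j < 2" "U = part f A d i" "V = part f B d j"
        by (auto simp: N_def matched_parts_def)
      then show ?thesis using size k part_subset[of f] by (auto simp: A_def B_def)
    qed (use blocks in blast)
  next
    fix P Q assume PQ: "P \<subseteq> A" "Q \<subseteq> B" "card P + card Q = 5"
    then consider "4 \<le> card P \<or> 4 \<le> card Q" | "card P = 3" "card Q = 2" | "card P = 2" "card Q = 3"
      by linarith
    then show "\<exists>(U, V)\<in>N \<union> G. 4 \<le> card (P \<inter> U) + card (Q \<inter> V)"
    proof cases
      case 1
      then show ?thesis using cov PQ by (simp add: N_def)
    next
      case 2
      then have "\<exists>(U, V)\<in>N. 4 \<le> card (P \<inter> U) + card (Q \<inter> V)"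
        using matched_parts_cover_3_2(1)[of "{..<2}" "{..<3}" A B f P Q] lab agree PQ
        by (simp add: N_def)
      then show ?thesis by blast
    next
      case 3
      then have "\<exists>(U, V)\<in>N. 4 \<le> card (P \<inter> U) + card (Q \<inter> V)"
        using matched_parts_cover_3_2(2)[of "{..<2}" "{..<3}" B A f Q P] lab agree PQ
        by (simp add: N_def Un_commute)
      then show ?thesis by blast
    qed
  qed (use AB G in \<open>auto simp: N_def card_matched_parts_le\<close>)
qed

text \<open>Each half has exactly 2k points and serves as its own extra block: 12 + 2.\<close>

lemma cover_number_4k_even:
  assumes "even k"
  shows "cover_number (4 * k) (2 * k) 4 5 \<le> 14"
proof -
  obtain w where k: "k = 2 * w" using assms by blast
  define H where "H = {..<4::nat} \<times> {..<w}"
  show ?thesis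
  proof (rule cover_number_4k_of_extra_blocks[where u = w and v = w and G = "{(H, {}), ({}, H)}"])
    fix P Q assume "P \<subseteq> {..<4::nat} \<times> {..<w}" "Q \<subseteq> {..<4::nat} \<times> {..<w}"
      "4 \<le> card P \<or> 4 \<le> card Q"
    then show "\<exists>(U, V)\<in>matched_parts (\<lambda>d p. table_K4 ! d ! fst p) {..<3} {..<2}
        ({..<4} \<times> {..<w}) ({..<4} \<times> {..<w}) \<union> {(H, {}), ({}, H)}. 4 \<le> card (P \<inter> U) + card (Q \<inter> V)"
      by (auto simp: H_def Int_absorb2)
  qed (use k in \<open>auto simp: H_def card_insert_if\<close>)
qed

text \<open>
  With \<open>k = 2u + 1\<close> the halves have \<open>2k + 2\<close> and \<open>2k - 2\<close> points. The larger one is too big for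
  a block and is replaced by four blocks, each omitting one of two points of group 0 and one of two
  points of group 1: four points in distinct groups are contained in one of them.
\<close>

lemma cover_number_4k_odd:
  assumes "odd k" "k \<ge> 2"
  shows "cover_number (4 * k) (2 * k) 4 5 \<le> 17"
proof -
  obtain u where k: "k = 2 * u + 1" using assms(1) by (elim oddE)
  then have u: "1 \<le> u" using assms(2) by simp
  define A B where "A = {..<4::nat} \<times> {..<u + 1}" and "B = {..<4::nat} \<times> {..<u}"
  define f where "f = (\<lambda>d (p :: nat \<times> nat). table_K4 ! d ! fst p)"
  define N where "N = matched_parts f {..<3} {..<2} A B"
  define pair :: "nat \<Rightarrow> nat \<Rightarrow> (nat \<times> nat) set" where "pair i j = {(0, i), (1, j)}" for i j
  \<comment> \<open>Five extra blocks: the smaller half, which fits into one block, and the four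
    trimmed copies of the larger half.\<close>
  define G where "G = insert ({}, B) ((\<lambda>(i, j). (A - pair i j, {})) ` ({..<2} \<times> {..<2}))"
  have AB: "finite A" "finite B" "card A = 4 * (u + 1)" "card B = 4 * u" by (auto simp: A_def B_def)
  have lab: "f d p < 2" if "d < 3" "p \<in> A \<union> B" for d p
    using that table_K4_less by (auto simp: f_def A_def B_def)
  have agree: "\<exists>d<3. f d p = f d q" if "p \<in> A" "q \<in> A" for p q
  proof -
    have "fst p < 4" "fst q < 4" using that by (auto simp: A_def)
    then show ?thesis using table_K4_agree unfolding f_def by blast
  qed
  have same_group: "f d p = f d q" if "fst p = fst q" for d p q
    using that by (simp add: f_def)
  have pair_cover: "\<exists>(U, V)\<in>G. 4 \<le> card (P \<inter> U) + card (Q \<inter> V)"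
    if P: "P \<subseteq> A" "i < 2" "j < 2" "card (P \<inter> pair i j) + 4 \<le> card P" for P Q i j
  proof (rule bexI)
    show "(A - pair i j, {}) \<in> G" using P by (auto simp: G_def)
    have "P \<inter> (A - pair i j) = P - P \<inter> pair i j" using P by blast
    moreover have "card \<dots> = card P - card (P \<inter> pair i j)"
      using finite_subset[OF P(1)] AB by (intro card_Diff_subset) auto
    ultimately show "case (A - pair i j, {}) of (U, V) \<Rightarrow> 4 \<le> card (P \<inter> U) + card (Q \<inter> V)"
      using P by simp
  qed
  have main: "\<exists>(U, V)\<in>N \<union> G. 4 \<le> card (P \<inter> U) + card (Q \<inter> V)"
    if PQ: "P \<subseteq> A" "Q \<subseteq> B" "card P + card Q = 5" "4 \<le> card P \<or> 4 \<le> card Q" for P Q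
  proof -
    have fin: "finite P" "finite Q" using PQ AB by (auto intro: finite_subset)
    have N_cover: ?thesis
      if "S \<subseteq> P" "T \<subseteq> Q" "d < 3" "\<forall>p\<in>S. f d p = f d x" "\<forall>q\<in>T. f d q = f d y"
        "x \<in> A" "y \<in> B" "4 \<le> card S + card T" for S T d x y
    proof -
      have "\<exists>(U, V)\<in>N. 4 \<le> card (P \<inter> U) + card (Q \<inter> V)"
        unfolding N_def
        by (rule matched_parts_cover[where S = S and T = T and d = d and i = "f d x" and j = "f d y"])
          (use that PQ fin lab[of d x] lab[of d y] in \<open>auto simp: part_def\<close>)
      then show ?thesis by blast
    qed
    consider "4 \<le> card Q" | "card P = 4" "card Q = 1" | "card P = 5" using PQ(3,4) by linarith
    then show ?thesis
    proof cases
      case 1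
      then show ?thesis using PQ by (intro bexI[of _ "({}, B)"]) (auto simp: G_def Int_absorb2)
    next
      case 2
      then obtain z where z: "Q = {z}" by (auto simp: card_1_singleton_iff)
      show ?thesis
      proof (cases "inj_on fst P")
        case True
        \<comment> \<open>By injectivity \<open>P\<close> has at most one point in each group, so
          one of the two candidates for omission is missing from \<open>P\<close>.\<close>
        have "\<exists>i<2. (g, i) \<notin> P" for g
          using inj_onD[OF True, of "(g, 0)" "(g, 1)"] by (auto simp: less_2_cases_iff)
        then obtain i j where "i < 2" "(0, i) \<notin> P" "j < 2" "(1, j) \<notin> P" by metis
        then have "P \<inter> pair i j = {}" by (auto simp: pair_def)
        then show ?thesis
          using pair_cover[OF PQ(1) \<open>i < 2\<close> \<open>j < 2\<close>, of Q] 2 by auto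
      next
        case False
        \<comment> \<open>Points of one group agree in every direction. Adding a third point
          \<open>r\<close> in a direction where it agrees with \<open>p\<close> gives 3 + 1 with the
          point of \<open>Q\<close>.\<close>
        then obtain p q where pq: "p \<in> P" "q \<in> P" "p \<noteq> q" "fst p = fst q" by (auto simp: inj_on_def)
        have "card (P - {p, q}) = 2" using pq 2 fin by (simp add: card_Diff_subset)
        then have "P - {p, q} \<noteq> {}" by force
        then obtain r where r: "r \<in> P" "r \<noteq> p" "r \<noteq> q" by blast
        then obtain d where d: "d < 3" "f d r = f d p" using agree[of r p] pq PQ by blast
        show ?thesis
          by (rule N_cover[where S = "{p, q, r}" and T = Q and d = d and x = p and y = z])
            (use pq(1-3) r d z PQ same_group[OF pq(4)[symmetric]] in auto)
      qed
    next
      case 3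
      show ?thesis
      proof (cases "\<exists>i<2. \<exists>j<2. (0, i) \<notin> P \<or> (1, j) \<notin> P")
        case True
        then obtain i j where ij: "i < 2" "j < 2" "(0, i) \<notin> P \<or> (1, j) \<notin> P" by blast
        have "card (P \<inter> pair i j) \<le> 1"
        proof -
          obtain x where "P \<inter> pair i j \<subseteq> {x}" using ij(3) by (auto simp: pair_def)
          from card_mono[OF _ this] show ?thesis by simp
        qed
        then show ?thesis using pair_cover[OF PQ(1) ij(1,2), of Q] 3 by auto
      next
        case False
        \<comment> \<open>If every omission would cost two points, \<open>P\<close> contains these
          four. Groups 0 and 1 share a class in direction 0, so a matched block contains all four;
          its class in \<open>B\<close> is arbitrary.\<close>
        define S :: "(nat \<times> nat) set" where "S = {(0, 0), (0, 1), (1, 0), (1, 1)}"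
        have "(0, i) \<in> P \<and> (1, j) \<in> P" if "i < 2" "j < 2" for i j
          using False that by blast
        from this[of 0 0] this[of 1 1] have S: "S \<subseteq> P" by (simp add: S_def)
        have "\<forall>p\<in>S. f 0 p = f 0 (0, 0)" by (auto simp: S_def f_def table_K4_def)
        moreover have "(0, 0) \<in> B" "(0, 0) \<in> A" using u by (auto simp: A_def B_def)
        moreover have "card S = 4" by (simp add: S_def)
        ultimately show ?thesis
          using N_cover[of S "{}" 0 "(0, 0)" "(0, 0)"] S by simp
      qed
    qed
  qed
  show ?thesis
  proof (rule cover_number_4k_of_extra_blocks[where u = "u + 1" and v = u and G = G])
    have "card ((\<lambda>(i, j). (A - pair i j, {} :: (nat \<times> nat) set)) ` ({..<2} \<times> {..<2})) \<le> 4"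
      using card_image_le[of "{..<2::nat} \<times> {..<2::nat}"] by fastforce
    then show "12 + card G \<le> 17" unfolding G_def by (simp add: card_insert_if)
    fix U V assume "(U, V) \<in> G"
    moreover have "card (A - pair i j) = 2 * k" if "i < 2" "j < 2" for i j
    proof -
      have "pair i j \<subseteq> A" using that u by (auto simp: pair_def A_def)
      then have "card (A - pair i j) = card A - card (pair i j)"
        by (intro card_Diff_subset) (auto simp: pair_def)
      then show ?thesis using AB k by (simp add: pair_def)
    qed
    ultimately show "U \<subseteq> {..<4} \<times> {..<u + 1} \<and> V \<subseteq> {..<4} \<times> {..<u} \<and> card U + card V \<le> 2 * k"
      using AB k by (auto simp: G_def A_def B_def)
  qed (use k main in \<open>auto simp: G_def N_def f_def A_def B_def\<close>)
qed

section \<open>The affine plane of order 4 and covers of 8k points\<close>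

text \<open>
  The five parallel classes of the affine plane over the field with four elements: the pairs
  \<open>(a, b)\<close> and \<open>(x, y)\<close> stand for field elements \<open>s\<close> and \<open>t\<close> in the basis \<open>1, \<omega>\<close>, and the labels are
  \<open>s\<close>, \<open>t\<close>, \<open>t + s\<close>, \<open>t + \<omega>s\<close> and \<open>t + \<omega>\<^sup>2s\<close>. Over the field with two
  elements the same sixteen points form a 4-space, whose thirty affine hyperplanes (the level sets
  of the nonzero functionals \<open>dot a\<close>) are the extra blocks of a half.
\<close>

definition ag24_label :: "nat \<Rightarrow> bool \<times> bool \<times> bool \<times> bool \<Rightarrow> bool \<times> bool" where
  "ag24_label d = (\<lambda>(a, b, x, y).
     [(a, b), (x, y), (x \<noteq> a, y \<noteq> b), (x \<noteq> b, y \<noteq> (a \<noteq> b)), (x \<noteq> (a \<noteq> b), y \<noteq> a)] ! d)"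

text \<open>In the field with two elements, \<open>\<noteq>\<close> on booleans is addition and
  \<open>\<and>\<close> is multiplication.\<close>

definition dot :: "bool \<times> bool \<times> bool \<times> bool \<Rightarrow> bool \<times> bool \<times> bool \<times> bool \<Rightarrow> bool" where
  "dot = (\<lambda>(c1, c2, c3, c4) (a, b, x, y). ((c1 \<and> a) \<noteq> (c2 \<and> b)) \<noteq> ((c3 \<and> x) \<noteq> (c4 \<and> y)))"

lemma ag24_label_agree: "\<forall>g h. \<exists>d<5. ag24_label d g = ag24_label d h"
  by code_simp

text \<open>Turns cardinalities over finite types into list lengths that \<open>code_simp\<close>
  can evaluate.\<close>

lemma card_Collect_enum: "card {x :: 'a :: enum. P x} = length (filter P Enum.enum)"
proof -
  have "{x :: 'a. P x} = set (filter P Enum.enum)" by (simp add: enum_UNIV)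
  then show ?thesis using distinct_card[OF distinct_filter[OF enum_distinct]] by metis
qed

lemma ag24_label_card: "\<forall>d<5. \<forall>l. card {g. ag24_label d g = l} = 4"
  unfolding card_Collect_enum by code_simp

lemma dot_card: "\<forall>a. a \<noteq> (False, False, False, False) \<longrightarrow> (\<forall>c. card {g. dot a g = c} = 8)"
  unfolding card_Collect_enum by code_simp

lemma card_UNIV_bools:
  "card (UNIV :: (bool \<times> bool) set) = 4" "card (UNIV :: (bool \<times> bool \<times> bool) set) = 8"
  "card (UNIV :: (bool \<times> bool \<times> bool \<times> bool) set) = 16"
  by (simp_all flip: UNIV_Times_UNIV add: card_cartesian_product)

text \<open>Four points lie in an affine hyperplane: three linear conditions on the 16 functionals
  have a nonzero solution. By pigeonhole two functionals have the same pattern of agreements with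
  the value at \<open>s\<close>, and their sum is such a solution.\<close>

lemma dot_constant_on_four:
  "\<exists>a. a \<noteq> (False, False, False, False) \<and> dot a p = dot a s \<and> dot a q = dot a s \<and> dot a r = dot a s"
proof -
  define g where "g a = (dot a p = dot a s, dot a q = dot a s, dot a r = dot a s)" for a
  have "card (range g) \<le> card (UNIV :: (bool \<times> bool \<times> bool) set)" by (intro card_mono) auto
  then have "card (range g) < card (UNIV :: (bool \<times> bool \<times> bool \<times> bool) set)" by (simp add: card_UNIV_bools)
  then have "\<not> inj g" by (rule pigeonhole)
  then obtain a b where ab: "a \<noteq> b" "g a = g b" unfolding inj_def by blast
  \<comment> \<open>The sum of \<open>a\<close> and \<open>b\<close>, nonzero because they
    differ.\<close>
  define c where "c = (case (a, b) of ((a1, a2, a3, a4), (b1, b2, b3, b4)) \<Rightarrow>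
    (a1 \<noteq> b1, a2 \<noteq> b2, a3 \<noteq> b3, a4 \<noteq> b4))"
  have c: "dot c x = (dot a x \<noteq> dot b x)" for x
    by (cases a; cases b; cases x) (auto simp: c_def dot_def)
  have "c \<noteq> (False, False, False, False)" using ab(1) by (cases a; cases b) (auto simp: c_def)
  then show ?thesis using ab(2) c by (intro exI[of _ c]) (auto simp: g_def)
qed

text \<open>There are 5 * 16 matched blocks and, in each half, at most 15 * 2 hyperplane blocks: 80
  + 60. Four labels defeat the pigeonhole argument for four points, but a hyperplane block always
  contains them.\<close>

lemma cover_number_8k:
  assumes "k mod 4 = 0"
  shows "cover_number (8 * k) (2 * k) 4 6 \<le> 140"
proof -
  obtain w where k: "k = 4 * w" using assms by auto
  define H where "H = (UNIV :: (bool \<times> bool \<times> bool \<times> bool) set) \<times> {..<w}"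
  define f where "f = (\<lambda>d (p :: (bool \<times> bool \<times> bool \<times> bool) \<times> nat). ag24_label d (fst p))"
  define I where "I = (- {(False, False, False, False)}) \<times> (UNIV :: bool set)"
  define flat where "flat = (\<lambda>x. {g. dot (fst x) g = snd x} \<times> {..<w})"
  define G where "G = flat ` I"
  have H: "finite H" "card H = 4 * k" by (auto simp: H_def k card_cartesian_product card_UNIV_bools)
  have "card I = 30" by (simp add: I_def card_cartesian_product Compl_eq_Diff_UNIV card_Diff_subset card_UNIV_bools)
  moreover have "finite I" by simp
  ultimately have G: "finite G" "card G \<le> 30" using card_image_le[of I flat] by (auto simp: G_def)
  have size: "card (part f H d l) = k" if "d < 5" for d l
  proof -
    have "part f H d l = {g. ag24_label d g = l} \<times> {..<w}"
      by (auto simp: part_def H_def f_def)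
    then show ?thesis using ag24_label_card that k by (cases l) (simp add: card_cartesian_product)
  qed
  have flat_card: "card U = 2 * k" if "U \<in> G" for U
  proof -
    obtain x where x: "x \<in> I" "U = {g. dot (fst x) g = snd x} \<times> {..<w}"
      using \<open>U \<in> G\<close> unfolding G_def flat_def by blast
    then have "card {g. dot (fst x) g = snd x} = 8"
      by (intro dot_card[rule_format]) (auto simp only: I_def mem_Times_iff Compl_iff singleton_iff)
    then show ?thesis using k x(2) by (simp add: card_cartesian_product)
  qed
  have four: "\<exists>U\<in>G. P \<subseteq> U" if "P \<subseteq> H" "card P = 4" for P
  proof -
    obtain p P' where "P = insert p P'" "card P' = 3"
      using \<open>card P = 4\<close> card_Suc_eq[of P 3] by auto
    then obtain q r s where P: "P = {p, q, r, s}" unfolding card_3_iff by blast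
    obtain a where a: "a \<noteq> (False, False, False, False)" "dot a (fst p) = dot a (fst s)"
      "dot a (fst q) = dot a (fst s)" "dot a (fst r) = dot a (fst s)"
      using dot_constant_on_four by blast
    have "x \<in> flat (a, dot a (fst s))" if "x \<in> P" for x
    proof -
      have "dot a (fst x) = dot a (fst s)" using that a unfolding P by blast
      then show ?thesis using that \<open>P \<subseteq> H\<close> by (auto simp: flat_def H_def)
    qed
    moreover have "flat (a, dot a (fst s)) \<in> G"
      unfolding G_def by (rule imageI) (simp add: I_def a(1))
    ultimately show ?thesis by blast
  qed
  have "cover_number (2 * card H) (2 * k) 4 6 \<le> 140"
  proof (rule cover_number_matched_parts[where f = f and D = "{..<5}" and L = UNIV and G = G])
    show "\<exists>d\<in>{..<5}. f d p = f d q" for p q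
      using ag24_label_agree[rule_format, of "fst p" "fst q"] unfolding f_def by blast
    fix P assume P: "P \<subseteq> H" "card P = 5"
    then have "4 \<le> card P" by simp
    then obtain R where R: "R \<subseteq> P" "card R = 4" by (rule obtain_subset_with_card_n)
    then obtain U where U: "U \<in> G" "R \<subseteq> U" using four[of R] P by blast
    have "card R \<le> card (P \<inter> U)"
      using R U P H by (intro card_mono) (auto intro: finite_subset)
    then show "\<exists>U\<in>G. 4 \<le> card (P \<inter> U)" using U R by auto
  next
    fix P d assume "P \<subseteq> H" "card P = 4"
    then show "(\<exists>p\<in>P. \<exists>q\<in>P. p \<noteq> q \<and> f d p = f d q) \<or> (\<exists>U\<in>G. P \<subseteq> U)"
      using four by blast
  next
    fix U assume "U \<in> G"
    then have "U \<subseteq> H" unfolding G_def flat_def H_def by blast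
    then show "U \<subseteq> H \<and> card U \<le> 2 * k" using flat_card[OF \<open>U \<in> G\<close>] by simp
  qed (use H G size in \<open>simp_all add: card_UNIV_bools\<close>)
  then show ?thesis using H by simp
qed

theorem theorem19:
  fixes k :: nat
  assumes "k \<ge> 2"
  shows "(even k \<longrightarrow> cover_number (4 * k) (2 * k) 4 5 \<le> 14) \<and>
         (odd k \<longrightarrow> cover_number (4 * k) (2 * k) 4 5 \<le> 18) \<and>
         (k mod 3 = 0 \<longrightarrow> cover_number (6 * k) (2 * k) 4 6 \<le> 42) \<and>
         (k mod 3 = 1 \<or> k mod 3 = 2 \<longrightarrow> cover_number (6 * k) (2 * k) 4 6 \<le> 51) \<and>
         (k mod 4 = 0 \<longrightarrow> cover_number (8 * k) (2 * k) 4 6 \<le> 140)"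
  \<comment> \<open>The odd case comes with the stronger bound 17.\<close>
  using cover_number_4k_even[of k] cover_number_4k_odd[of k] cover_number_6k_3_dvd[of k]
    cover_number_6k[of k] cover_number_8k[of k] assms
  by auto

end
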